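(* Let $A$ be a commutative unital ring of characteristic zero, let $n\ge 1$, and let $G=(G_1,\ldots,G_n)$ be an $n$-tuple of formal power series in the $n$ variables $\mathbf{x}=(x_1,\ldots,x_n)$ with coefficients in $A$, where each $G_i$ has the form $$G_i(\mathbf{x})=x_i+\sum_{s_1+\cdots+s_n>1}\gamma^{(i)}_{(s_1,\ldots,s_n)}\,x_1^{s_1}\cdots x_n^{s_n}.$$ Let $G^{-1}$ be the compositional inverse of $G$ (as an $n$-tuple of power series in $n$ variables), and define $$\Phi(\mathbf{x},\mathbf{y}):=G^{-1}\big(G(\mathbf{x})+G(\mathbf{y})\big),\qquad \Psi(\mathbf{x},\mathbf{y}):=G^{-1}\big(G_1(\mathbf{x})\,G_1(\mathbf{y}),\ldots,G_n(\mathbf{x})\,G_n(\mathbf{y})\big).$$ Then the triple $(A,\Phi,\Psi)$ is an $n$-dimensional commutative formal ring.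
   Context: All rings are associative, commutative and unital. An $n$-dimensional formal group law over $A$ is an $n$-tuple $\Phi=(\Phi_1,\ldots,\Phi_n)$ of formal power series over $A$ in the $2n$ indeterminates $\mathbf{x}=(x_1,\ldots,x_n)$, $\mathbf{y}=(y_1,\ldots,y_n)$ such that $\Phi_i(\mathbf{x},\mathbf{y})=x_i+y_i$ modulo terms of degree $\ge 2$, and $\Phi(\Phi(\mathbf{x},\mathbf{y}),\mathbf{z})=\Phi(\mathbf{x},\Phi(\mathbf{y},\mathbf{z}))$; it is commutative if $\Phi_i(\mathbf{x},\mathbf{y})=\Phi_i(\mathbf{y},\mathbf{x})$ for all $i$. An $n$-dimensional formal ring over $A$ is a triple $(A,\Phi,\Psi)$ where $\Phi=(\Phi_1,\ldots,\Phi_n)$ and $\Psi=(\Psi_1,\ldots,\Psi_n)$ are $n$-tuples of formal power series over $A$ in the $2n$ variables $(\mathbf{x},\mathbf{y})$ (those of $\Psi$ having zero constant term, so that the substitutions below make sense) such that: (i) $\Phi$ is a commutative $n$-dimensional formal group law; (ii) $\Psi(\Psi(\mathbf{x},\mathbf{y}),\mathbf{z})=\Psi(\mathbf{x},\Psi(\mathbf{y},\mathbf{z}))$; (iii) $\Psi(\mathbf{x},\Phi(\mathbf{y},\mathbf{z}))=\Phi(\Psi(\mathbf{x},\mathbf{y}),\Psi(\mathbf{x},\mathbf{z}))$ and $\Psi(\Phi(\mathbf{x},\mathbf{y}),\mathbf{z})=\Phi(\Psi(\mathbf{x},\mathbf{z}),\Psi(\mathbf{y},\mathbf{z}))$. It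 is called commutative if $\Psi(\mathbf{x},\mathbf{y})=\Psi(\mathbf{y},\mathbf{x})$. *)

theory Defs
  imports "HOL-Library.FuncSet" "HOL-Library.Groups_Big_Fun"
begin

section \<open>Formal power series in finitely many variables\<close>

text \<open>
  The variables are the elements of a finite type \<open>'v\<close>, a monomial is its exponent vector
  \<open>'v \<Rightarrow> nat\<close>, and a power series is its family of coefficients.
\<close>

typedef ('v, 'a) mfps = "UNIV :: (('v \<Rightarrow> nat) \<Rightarrow> 'a) set"
  morphisms mfps_coeff Abs_mfps by simp

setup_lifting type_definition_mfps

lemma mfps_eq_iff: "f = g \<longleftrightarrow> (\<forall>m. mfps_coeff f m = mfps_coeff g m)"
  by transfer auto

definition mdegree :: "('v::finite \<Rightarrow> nat) \<Rightarrow> nat" where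
  "mdegree m = (\<Sum>i\<in>UNIV. m i)"

lemma finite_exponents_le: "finite {k. k \<le> (m :: 'v::finite \<Rightarrow> nat)}"
proof (rule finite_subset)
  show "{k. k \<le> m} \<subseteq> PiE UNIV (\<lambda>i. {..m i})"
    by (auto simp: le_fun_def PiE_def)
  show "finite (PiE (UNIV :: 'v set) (\<lambda>i. {..m i}))"
    by (rule finite_PiE) auto
qed

instantiation mfps :: (finite, comm_ring_1) comm_ring_1
begin

lift_definition zero_mfps :: "('a, 'b) mfps" is "\<lambda>m. 0" .

lift_definition one_mfps :: "('a, 'b) mfps" is "\<lambda>m. if m = (\<lambda>_. 0) then 1 else 0" .

lift_definition plus_mfps :: "('a, 'b) mfps \<Rightarrow> ('a, 'b) mfps \<Rightarrow> ('a, 'b) mfps"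
  is "\<lambda>f g m. f m + g m" .

lift_definition minus_mfps :: "('a, 'b) mfps \<Rightarrow> ('a, 'b) mfps \<Rightarrow> ('a, 'b) mfps"
  is "\<lambda>f g m. f m - g m" .

lift_definition uminus_mfps :: "('a, 'b) mfps \<Rightarrow> ('a, 'b) mfps"
  is "\<lambda>f m. - f m" .

lift_definition times_mfps :: "('a, 'b) mfps \<Rightarrow> ('a, 'b) mfps \<Rightarrow> ('a, 'b) mfps"
  is "\<lambda>f g m. \<Sum>k | k \<le> m. f k * g (\<lambda>i. m i - k i)" .

instance
proof
  fix a b c :: "('a, 'b) mfps"
  show "a + b + c = a + (b + c)" "a + b = b + a" "0 + a = a" "- a + a = 0" "a - b = a + - b"
    by (transfer; simp add: fun_eq_iff algebra_simps)+
  show "(a + b) * c = a * c + b * c"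
    by transfer (simp add: fun_eq_iff algebra_simps sum.distrib)
  show "(0 :: ('a, 'b) mfps) \<noteq> 1"
    by transfer (auto simp: fun_eq_iff)
  show "1 * a = a"
  proof (transfer, rule ext)
    fix a :: "('a \<Rightarrow> nat) \<Rightarrow> 'b" and m
    have "(\<Sum>k | k \<le> m. (if k = (\<lambda>_. 0) then 1 else 0) * a (\<lambda>i. m i - k i)) =
          (\<Sum>k\<in>{\<lambda>_. 0}. a (\<lambda>i. m i - k i))"
      by (intro sum.mono_neutral_cong_right finite_exponents_le) (auto simp: le_fun_def)
    then show "(\<Sum>k | k \<le> m. (if k = (\<lambda>_. 0) then 1 else 0) * a (\<lambda>i. m i - k i)) = a m"
      by simp
  qed
  show "a * b = b * a"
  proof (transfer, rule ext)
    fix a b :: "('a \<Rightarrow> nat) \<Rightarrow> 'b" and m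
    show "(\<Sum>k | k \<le> m. a k * b (\<lambda>i. m i - k i)) = (\<Sum>k | k \<le> m. b k * a (\<lambda>i. m i - k i))"
      by (rule sum.reindex_bij_witness[where i = "\<lambda>k i. m i - k i" and j = "\<lambda>k i. m i - k i"])
         (auto simp: le_fun_def mult.commute)
  qed
  show "a * b * c = a * (b * c)"
  proof (transfer, rule ext)
    fix a b c :: "('a \<Rightarrow> nat) \<Rightarrow> 'b" and m
    have "(\<Sum>k | k \<le> m. (\<Sum>l | l \<le> k. a l * b (\<lambda>i. k i - l i)) * c (\<lambda>i. m i - k i)) =
          (\<Sum>(k, l)\<in>Sigma {k. k \<le> m} (\<lambda>k. {l. l \<le> k}).
             a l * b (\<lambda>i. k i - l i) * c (\<lambda>i. m i - k i))"
      by (simp add: sum.Sigma finite_exponents_le sum_distrib_right)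
    also have "\<dots> = (\<Sum>(l, j)\<in>Sigma {l. l \<le> m} (\<lambda>l. {j. j \<le> (\<lambda>i. m i - l i)}).
             a l * (b j * c (\<lambda>i. m i - l i - j i)))"
      by (rule sum.reindex_bij_witness[where i = "\<lambda>(l, j). (\<lambda>i. l i + j i, l)"
            and j = "\<lambda>(k, l). (l, \<lambda>i. k i - l i)"])
         (auto simp: le_fun_def fun_eq_iff algebra_simps intro: order_trans diff_le_mono
            simp: le_diff_conv2)
    also have "\<dots> = (\<Sum>l | l \<le> m. a l *
             (\<Sum>j | j \<le> (\<lambda>i. m i - l i). b j * c (\<lambda>i. m i - l i - j i)))"
      by (simp add: sum.Sigma finite_exponents_le sum_distrib_left)
    finally show "(\<Sum>k | k \<le> m. (\<Sum>l | l \<le> k. a l * b (\<lambda>i. k i - l i)) * c (\<lambda>i. m i - k i)) =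
      (\<Sum>l | l \<le> m. a l * (\<Sum>j | j \<le> (\<lambda>i. m i - l i). b j * c (\<lambda>i. m i - l i - j i)))" .
  qed
qed

end

lift_definition mfps_var :: "'v \<Rightarrow> ('v::finite, 'a::comm_ring_1) mfps" is
  "\<lambda>i m. if m = (\<lambda>j. if j = i then 1 else 0) then 1 else 0" .

definition mfps_const_term :: "('v::finite, 'a::comm_ring_1) mfps \<Rightarrow> 'a" where
  "mfps_const_term f = mfps_coeff f (\<lambda>_. 0)"

definition mfps_cong_deg2 :: "('v::finite, 'a::comm_ring_1) mfps \<Rightarrow> ('v, 'a) mfps \<Rightarrow> bool" where
  "mfps_cong_deg2 f g \<longleftrightarrow> (\<forall>m. mdegree m < 2 \<longrightarrow> mfps_coeff f m = mfps_coeff g m)"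

subsection \<open>Substitution\<close>

text \<open>
  \<open>mfps_subst F f\<close> is \<open>\<Sum>s. f\<^sub>s * (\<Prod>i. F i ^ s i)\<close>, computed coefficientwise.
  If every \<open>F i\<close> has zero constant term, only the finitely many \<open>s\<close> with
  \<open>mdegree s \<le> mdegree m\<close> contribute to the coefficient of \<open>m\<close>; the definition is meaningful
  only in this case (\<^const>\<open>Sum_any\<close> is 0 when there are infinitely many nonzero terms).
\<close>

definition mfps_subst ::
  "('v \<Rightarrow> ('w, 'a) mfps) \<Rightarrow> ('v::finite, 'a) mfps \<Rightarrow> ('w::finite, 'a::comm_ring_1) mfps" where
  "mfps_subst F f =
     Abs_mfps (\<lambda>m. Sum_any (\<lambda>s. mfps_coeff f s * mfps_coeff (\<Prod>i\<in>UNIV. F i ^ s i) m))"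

definition mfps_compose ::
  "('n \<Rightarrow> ('v::finite, 'a) mfps) \<Rightarrow> ('v \<Rightarrow> ('w, 'a) mfps) \<Rightarrow> 'n \<Rightarrow> ('w::finite, 'a::comm_ring_1) mfps"
  where "mfps_compose P F = (\<lambda>i. mfps_subst F (P i))"

text \<open>
  The two-sided inverse is unique when it exists, and it exists if the linear part of \<open>G\<close> is the
  identity and the constant terms vanish.
\<close>

definition mfps_comp_inverse ::
  "('n::finite \<Rightarrow> ('n, 'a::comm_ring_1) mfps) \<Rightarrow> 'n \<Rightarrow> ('n, 'a) mfps" where
  "mfps_comp_inverse G = (THE H. (\<forall>i. mfps_const_term (H i) = 0) \<and>
     mfps_compose G H = mfps_var \<and> mfps_compose H G = mfps_var)"


section \<open>Formal group laws and formal rings\<close>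

text \<open>
  An \<open>n\<close>-tuple of series in \<open>(x, y)\<close> is indexed by a finite type \<open>'n\<close> with \<open>n\<close> elements and has
  variables in \<open>'n + 'n\<close>: \<open>Inl i\<close> stands for \<open>x\<^sub>i\<close> and \<open>Inr i\<close> for \<open>y\<^sub>i\<close>.
  \<open>mfps_apply2 P a b\<close> is \<open>P(a, b)\<close>.
\<close>

definition mfps_apply2 ::
  "('n::finite \<Rightarrow> ('n + 'n, 'a) mfps) \<Rightarrow> ('n \<Rightarrow> ('w, 'a) mfps) \<Rightarrow> ('n \<Rightarrow> ('w, 'a) mfps)
     \<Rightarrow> 'n \<Rightarrow> ('w::finite, 'a::comm_ring_1) mfps" where
  "mfps_apply2 P a b = mfps_compose P (case_sum a b)"

definition x2 :: "'n::finite \<Rightarrow> ('n + 'n, 'a::comm_ring_1) mfps" where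
  "x2 i = mfps_var (Inl i)"
definition y2 :: "'n::finite \<Rightarrow> ('n + 'n, 'a::comm_ring_1) mfps" where
  "y2 i = mfps_var (Inr i)"

definition x3 :: "'n::finite \<Rightarrow> ('n + 'n + 'n, 'a::comm_ring_1) mfps" where
  "x3 i = mfps_var (Inl i)"
definition y3 :: "'n::finite \<Rightarrow> ('n + 'n + 'n, 'a::comm_ring_1) mfps" where
  "y3 i = mfps_var (Inr (Inl i))"
definition z3 :: "'n::finite \<Rightarrow> ('n + 'n + 'n, 'a::comm_ring_1) mfps" where
  "z3 i = mfps_var (Inr (Inr i))"

definition formal_group_law ::
  "('n::finite \<Rightarrow> ('n + 'n, 'a::comm_ring_1) mfps) \<Rightarrow> bool" where
  "formal_group_law \<Phi> \<longleftrightarrow>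
     (\<forall>i. mfps_cong_deg2 (\<Phi> i) (x2 i + y2 i)) \<and>
     mfps_apply2 \<Phi> (mfps_apply2 \<Phi> x3 y3) z3 = mfps_apply2 \<Phi> x3 (mfps_apply2 \<Phi> y3 z3)"

definition mfps_symmetric ::
  "('n::finite \<Rightarrow> ('n + 'n, 'a::comm_ring_1) mfps) \<Rightarrow> bool" where
  "mfps_symmetric P \<longleftrightarrow> mfps_apply2 P x2 y2 = mfps_apply2 P y2 x2"

text \<open>The coefficient ring of a formal ring is the type \<open>'a\<close>; \<open>\<Psi>\<close> need not have a unit.\<close>

definition formal_ring ::
  "('n::finite \<Rightarrow> ('n + 'n, 'a::comm_ring_1) mfps) \<Rightarrow> ('n \<Rightarrow> ('n + 'n, 'a) mfps) \<Rightarrow> bool" where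
  "formal_ring \<Phi> \<Psi> \<longleftrightarrow>
     formal_group_law \<Phi> \<and> mfps_symmetric \<Phi> \<and>
     (\<forall>i. mfps_const_term (\<Psi> i) = 0) \<and>
     mfps_apply2 \<Psi> (mfps_apply2 \<Psi> x3 y3) z3 = mfps_apply2 \<Psi> x3 (mfps_apply2 \<Psi> y3 z3) \<and>
     mfps_apply2 \<Psi> x3 (mfps_apply2 \<Phi> y3 z3) =
       mfps_apply2 \<Phi> (mfps_apply2 \<Psi> x3 y3) (mfps_apply2 \<Psi> x3 z3) \<and>
     mfps_apply2 \<Psi> (mfps_apply2 \<Phi> x3 y3) z3 =
       mfps_apply2 \<Phi> (mfps_apply2 \<Psi> x3 z3) (mfps_apply2 \<Psi> y3 z3)"

definition commutative_formal_ring ::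
  "('n::finite \<Rightarrow> ('n + 'n, 'a::comm_ring_1) mfps) \<Rightarrow> ('n \<Rightarrow> ('n + 'n, 'a) mfps) \<Rightarrow> bool" where
  "commutative_formal_ring \<Phi> \<Psi> \<longleftrightarrow> formal_ring \<Phi> \<Psi> \<and> mfps_symmetric \<Psi>"

end

theory Submission imports Defs begin

text \<open>
  \<open>G\<close> is a change of coordinates that carries the coordinatewise ring structure on \<open>n\<close>-space to
  \<open>(\<Phi>, \<Psi>)\<close>. With \<open>H = G\<inverse>\<close>, substitution into the definitions gives
  \<open>\<Phi>(a, b) = H(G(a) + G(b))\<close> and \<open>\<Psi>(a, b) = H(G(a) G(b))\<close>, hence
  \<open>G(\<Phi>(a, b)) = G(a) + G(b)\<close> and \<open>G(\<Psi>(a, b)) = G(a) G(b)\<close>. In a nested expression each \<open>G\<close>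
  thus meets the \<open>H\<close> below it and cancels; what remains on both sides of an axiom is \<open>H\<close> applied
  to a polynomial expression in \<open>G(x)\<close>, \<open>G(y)\<close>, \<open>G(z)\<close>, and the two agree by associativity,
  commutativity or distributivity in the ring of power series
  (\<open>apply2_transported\<close>, \<open>compose_G_H\<close>, \<open>commutative_formal_ring_transported\<close>).

  Two facts about substitution carry this argument. First, for series \<open>F i\<close> without constant term
  the map \<open>f \<mapsto> f(F)\<close> is a ring homomorphism, and so composition is associative (\<open>subst_mult\<close>,
  \<open>subst_subst\<close>). The infinite sums cause no difficulty: the monomial \<open>F\<^sup>s\<close> vanishes to order
  \<open>|s|\<close>, so every coefficient is a finite sum, and that sum may be extended to any larger degree
  bound (\<open>coeff_subst\<close>).

  Second, the inverse exists. As \<open>G\<^sup>s\<close> has the same leading form \<open>x\<^sup>s\<close> as the corresponding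
  monomial in the variables, \<open>f \<mapsto> f(G)\<close> is a unitriangular system in the coefficients of \<open>f\<close>,
  ordered by degree (\<open>coeff_subst_triangular\<close>). Solving it for the right-hand sides \<open>x\<^sub>i\<close> gives a
  left inverse \<open>H\<close> that is again the identity in degree below 2. So \<open>H\<close> has a left inverse too,
  and in a monoid this makes \<open>H\<close> the unique two-sided inverse of \<open>G\<close> (\<open>comp_inverse\<close>).
\<close>

section \<open>The filtration by order of vanishing\<close>

definition mfps_order_ge :: "nat \<Rightarrow> ('v::finite, 'a::comm_ring_1) mfps \<Rightarrow> bool" where
  "mfps_order_ge d f \<longleftrightarrow> (\<forall>m. mdegree m < d \<longrightarrow> mfps_coeff f m = 0)"

lemma mdegree_zero [simp]: "mdegree (\<lambda>_. 0) = 0"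
  by (simp add: mdegree_def)

lemma mdegree_eq_0_iff: "mdegree m = 0 \<longleftrightarrow> m = (\<lambda>_. 0)"
  by (auto simp: mdegree_def)

lemma mdegree_add: "mdegree (\<lambda>i. k i + l i) = mdegree k + mdegree l"
  by (simp add: mdegree_def sum.distrib)

lemma mdegree_split:
  assumes "k \<le> m"
  shows "mdegree m = mdegree k + mdegree (\<lambda>i. m i - k i)"
proof -
  have "(\<lambda>i. k i + (m i - k i)) = m"
    using assms by (auto simp: le_fun_def)
  then show ?thesis
    using mdegree_add[of k "\<lambda>i. m i - k i"] by simp
qed

lemma mdegree_mono: "k \<le> m \<Longrightarrow> mdegree k \<le> mdegree m"
  using mdegree_split[of k m] by simp

lemma finite_mdegree_le: "finite {s :: 'v::finite \<Rightarrow> nat. mdegree s \<le> N}"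
proof (rule finite_subset)
  have "s i \<le> mdegree s" for s :: "'v \<Rightarrow> nat" and i
    by (simp add: mdegree_def member_le_sum)
  then show "{s :: 'v \<Rightarrow> nat. mdegree s \<le> N} \<subseteq> {k. k \<le> (\<lambda>_. N)}"
    by (fastforce simp: le_fun_def intro: order_trans)
qed (rule finite_exponents_le)

lemma const_term_eq_0_iff: "mfps_const_term f = 0 \<longleftrightarrow> mfps_order_ge 1 f"
  by (auto simp: mfps_const_term_def mfps_order_ge_def mdegree_eq_0_iff)

lemma cong_deg2_iff: "mfps_cong_deg2 f g \<longleftrightarrow> mfps_order_ge 2 (f - g)"
  by (simp add: mfps_cong_deg2_def mfps_order_ge_def minus_mfps.rep_eq)

lemma order_ge_0 [simp]: "mfps_order_ge 0 f"
  by (simp add: mfps_order_ge_def)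

lemma order_ge_mono: "mfps_order_ge e f \<Longrightarrow> d \<le> e \<Longrightarrow> mfps_order_ge d f"
  by (simp add: mfps_order_ge_def)

lemma order_ge_add: "mfps_order_ge d f \<Longrightarrow> mfps_order_ge d g \<Longrightarrow> mfps_order_ge d (f + g)"
  by (simp add: mfps_order_ge_def plus_mfps.rep_eq)

lemma order_ge_mult:
  fixes f g :: "('v::finite, 'a::comm_ring_1) mfps"
  assumes "mfps_order_ge d f" and "mfps_order_ge e g"
  shows "mfps_order_ge (d + e) (f * g)"
  unfolding mfps_order_ge_def times_mfps.rep_eq
proof (intro allI impI sum.neutral ballI)
  fix m k :: "'v \<Rightarrow> nat"
  assume m: "mdegree m < d + e" and k: "k \<in> {k. k \<le> m}"
  have "mdegree k < d \<or> mdegree (\<lambda>i. m i - k i) < e"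
    using m mdegree_split[of k m] k by auto
  then show "mfps_coeff f k * mfps_coeff g (\<lambda>i. m i - k i) = 0"
    using assms by (auto simp: mfps_order_ge_def)
qed

text \<open>
  Requiring the order bound on both series makes the relation multiplicative, and the case
  \<open>f = g\<close> recovers the bound itself; one induction over a monomial then serves both to bound its
  order and to compare it with another monomial.
\<close>

definition mfps_same_leading ::
  "nat \<Rightarrow> ('v::finite, 'a::comm_ring_1) mfps \<Rightarrow> ('v, 'a) mfps \<Rightarrow> bool" where
  "mfps_same_leading d f g \<longleftrightarrow>
     mfps_order_ge d f \<and> mfps_order_ge d g \<and> mfps_order_ge (Suc d) (f - g)"

lemma same_leading_refl_iff [simp]: "mfps_same_leading d f f \<longleftrightarrow> mfps_order_ge d f"
  by (auto simp: mfps_same_leading_def mfps_order_ge_def zero_mfps.rep_eq)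

lemma same_leading_mult:
  assumes "mfps_same_leading d f f'" and "mfps_same_leading e g g'"
  shows "mfps_same_leading (d + e) (f * g) (f' * g')"
proof -
  have "f * g - f' * g' = (f - f') * g + f' * (g - g')"
    by (simp add: algebra_simps)
  then show ?thesis
    using assms order_ge_mult[of "Suc d" "f - f'" e g] order_ge_mult[of d f' "Suc e" "g - g'"]
    by (auto simp: mfps_same_leading_def intro: order_ge_mult order_ge_add)
qed

lemma same_leading_power:
  assumes "mfps_same_leading 1 f g"
  shows "mfps_same_leading n (f ^ n) (g ^ n)"
proof (induction n)
  case (Suc n)
  then show ?case
    using same_leading_mult[OF assms Suc.IH] by simp
qed simp

text \<open>
  The reason why substitution is triangular: changing each \<open>F i\<close> from degree 2 on leaves the
  leading form of the product, which sits in degree \<open>mdegree s\<close>, untouched.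
\<close>

lemma same_leading_monomial:
  assumes "\<And>i. mfps_same_leading 1 (F i) (F' i)"
  shows "mfps_same_leading (mdegree s) (\<Prod>i\<in>UNIV. F i ^ s i) (\<Prod>i\<in>UNIV. F' i ^ s i)"
proof -
  have "mfps_same_leading (\<Sum>i\<in>A. s i) (\<Prod>i\<in>A. F i ^ s i) (\<Prod>i\<in>A. F' i ^ s i)"
    if "finite A" for A
    using that
  proof induction
    case (insert i A)
    then show ?case
      using same_leading_mult[OF same_leading_power[OF assms] insert.IH, of "s i" i] by simp
  qed simp
  then show ?thesis
    by (simp add: mdegree_def)
qed

lemma order_ge_monomial:
  assumes "\<And>i. mfps_const_term (F i) = 0"
  shows "mfps_order_ge (mdegree s) (\<Prod>i\<in>UNIV. F i ^ s i)"
  using same_leading_monomial[of F F s] assms by (simp add: const_term_eq_0_iff)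

section \<open>Substitution is a ring homomorphism\<close>

text \<open>
  The bound \<open>N\<close> is free so that coefficients of several exponents, as they occur in a convolution
  or in a nested substitution, become sums over one common finite index set.
\<close>

lemma coeff_subst:
  assumes F: "\<And>i. mfps_const_term (F i) = 0" and "mdegree m \<le> N"
  shows "mfps_coeff (mfps_subst F f) m =
    (\<Sum>s | mdegree s \<le> N. mfps_coeff f s * mfps_coeff (\<Prod>i\<in>UNIV. F i ^ s i) m)"
proof -
  have "mfps_coeff (\<Prod>i\<in>UNIV. F i ^ s i) m = 0" if "\<not> mdegree s \<le> N" for s
    using order_ge_monomial[OF F, of s] assms(2) that by (simp add: mfps_order_ge_def)
  then have "{s. mfps_coeff f s * mfps_coeff (\<Prod>i\<in>UNIV. F i ^ s i) m \<noteq> 0} \<subseteq> {s. mdegree s \<le> N}"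
    by (auto intro: ccontr)
  then show ?thesis
    unfolding mfps_subst_def
    by (simp add: Abs_mfps_inverse Sum_any.expand_superset[OF finite_mdegree_le])
qed

lemma subst_add:
  assumes "\<And>i. mfps_const_term (F i) = 0"
  shows "mfps_subst F (f + g) = mfps_subst F f + mfps_subst F g"
  by (simp add: mfps_eq_iff plus_mfps.rep_eq coeff_subst[OF assms order_refl] sum.distrib
      distrib_right)

lemma subst_1:
  assumes "\<And>i. mfps_const_term (F i) = 0"
  shows "mfps_subst F 1 = 1"
  unfolding mfps_eq_iff
proof
  fix m
  have "mfps_coeff (mfps_subst F 1) m =
      (\<Sum>s\<in>{\<lambda>_. 0}. mfps_coeff (\<Prod>i\<in>UNIV. F i ^ s i) m)"
    unfolding coeff_subst[OF assms order_refl]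
    by (intro sum.mono_neutral_cong_right finite_mdegree_le) (auto simp: one_mfps.rep_eq)
  then show "mfps_coeff (mfps_subst F 1) m = mfps_coeff 1 m"
    by simp
qed

text \<open>
  Both sides equal \<open>\<Sum>\<^sub>k\<^sub>,\<^sub>l f\<^sub>k g\<^sub>l F\<^sup>k F\<^sup>l\<close>: on the left by \<open>F\<^sup>s = F\<^sup>k F\<^sup>l\<close> for \<open>s = k + l\<close>, on the right by
  expanding the convolution.
\<close>

lemma subst_mult:
  fixes F :: "'v::finite \<Rightarrow> ('w::finite, 'a::comm_ring_1) mfps"
  assumes F: "\<And>i. mfps_const_term (F i) = 0"
  shows "mfps_subst F (f * g) = mfps_subst F f * mfps_subst F g"
  unfolding mfps_eq_iff
proof
  fix m :: "'w \<Rightarrow> nat"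
  define M where "M = (\<lambda>s. \<Prod>i\<in>UNIV. F i ^ s i)"
  define D where "D = {s :: 'v \<Rightarrow> nat. mdegree s \<le> mdegree m}"
  have fin: "finite D"
    unfolding D_def by (rule finite_mdegree_le)
  have M_add: "M (\<lambda>i. k i + l i) = M k * M l" for k l
    by (simp add: M_def power_add prod.distrib)
  have coeff: "mfps_coeff (mfps_subst F h) p = (\<Sum>s\<in>D. mfps_coeff h s * mfps_coeff (M s) p)"
    if "p \<le> m" for h p
    unfolding D_def M_def by (rule coeff_subst[OF F mdegree_mono[OF that]])
  have "mfps_coeff (mfps_subst F (f * g)) m =
      (\<Sum>s\<in>D. \<Sum>k | k \<le> s. mfps_coeff f k * mfps_coeff g (\<lambda>i. s i - k i) * mfps_coeff (M s) m)"
    by (simp add: coeff times_mfps.rep_eq sum_distrib_right)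
  also have "\<dots> = (\<Sum>(s, k)\<in>Sigma D (\<lambda>s. {k. k \<le> s}).
      mfps_coeff f k * mfps_coeff g (\<lambda>i. s i - k i) * mfps_coeff (M s) m)"
    by (simp add: sum.Sigma fin finite_exponents_le)
  also have "\<dots> = (\<Sum>(k, l) | mdegree k + mdegree l \<le> mdegree m.
      mfps_coeff f k * mfps_coeff g l * mfps_coeff (M k * M l) m)"
    by (rule sum.reindex_bij_witness[where i = "\<lambda>(k, l). (\<lambda>i. k i + l i, k)"
          and j = "\<lambda>(s, k). (k, \<lambda>i. s i - k i)"])
      (auto simp: le_fun_def D_def mdegree_add mdegree_split M_add[symmetric])
  \<comment> \<open>The pairs added to the triangle to fill the square contribute 0, as \<open>F\<^sup>k F\<^sup>l\<close> has order at
    least \<open>|k| + |l|\<close>.\<close>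
  also have "\<dots> = (\<Sum>(k, l)\<in>D \<times> D. mfps_coeff f k * mfps_coeff g l * mfps_coeff (M k * M l) m)"
  proof (rule sum.mono_neutral_left)
    have "mfps_coeff (M k * M l) m = 0" if "mdegree m < mdegree k + mdegree l" for k l
      using order_ge_mult[OF order_ge_monomial[OF F, of k] order_ge_monomial[OF F, of l]] that
      by (simp add: mfps_order_ge_def M_def)
    then show "\<forall>p\<in>D \<times> D - {(k, l). mdegree k + mdegree l \<le> mdegree m}.
        (case p of (k, l) \<Rightarrow> mfps_coeff f k * mfps_coeff g l * mfps_coeff (M k * M l) m) = 0"
      by clarsimp (metis mult_zero_right not_le)
  qed (auto simp: fin, auto simp: D_def)
  also have "\<dots> = (\<Sum>k\<in>D. \<Sum>l\<in>D. \<Sum>p | p \<le> m. (mfps_coeff f k * mfps_coeff (M k) p) *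
      (mfps_coeff g l * mfps_coeff (M l) (\<lambda>i. m i - p i)))"
    by (simp add: sum.cartesian_product[symmetric] times_mfps.rep_eq sum_distrib_left mult_ac)
  also have "\<dots> = (\<Sum>p | p \<le> m. \<Sum>k\<in>D. \<Sum>l\<in>D. (mfps_coeff f k * mfps_coeff (M k) p) *
      (mfps_coeff g l * mfps_coeff (M l) (\<lambda>i. m i - p i)))"
    by (simp add: sum.swap[of _ "{p. p \<le> m}"])
  also have "\<dots> = mfps_coeff (mfps_subst F f * mfps_subst F g) m"
    unfolding times_mfps.rep_eq
    by (intro sum.cong refl) (simp add: coeff le_fun_def sum_product)
  finally show "mfps_coeff (mfps_subst F (f * g)) m = mfps_coeff (mfps_subst F f * mfps_subst F g) m" .
qed

lemma subst_monomial:
  fixes F :: "'v::finite \<Rightarrow> ('w::finite, 'a::comm_ring_1) mfps"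
    and H :: "'u::finite \<Rightarrow> ('v, 'a) mfps"
  assumes "\<And>i. mfps_const_term (F i) = 0"
  shows "mfps_subst F (\<Prod>i\<in>UNIV. H i ^ s i) = (\<Prod>i\<in>UNIV. mfps_subst F (H i) ^ s i)"
proof -
  have power: "mfps_subst F (h ^ n) = mfps_subst F h ^ n" for h n
    by (induction n) (simp_all add: subst_1 subst_mult assms)
  have "mfps_subst F (\<Prod>i\<in>A. H i ^ s i) = (\<Prod>i\<in>A. mfps_subst F (H i) ^ s i)" if "finite A" for A :: "'u set"
    using that by induction (simp_all add: subst_1 subst_mult power assms)
  then show ?thesis
    by simp
qed

lemma order_ge_subst:
  fixes F :: "'v::finite \<Rightarrow> ('w::finite, 'a::comm_ring_1) mfps"
  assumes F: "\<And>i. mfps_const_term (F i) = 0" and f: "mfps_order_ge d f"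
  shows "mfps_order_ge d (mfps_subst F f)"
  unfolding mfps_order_ge_def
proof (intro allI impI)
  fix m :: "'w \<Rightarrow> nat"
  assume "mdegree m < d"
  then show "mfps_coeff (mfps_subst F f) m = 0"
    unfolding coeff_subst[OF F order_refl]
    using f by (intro sum.neutral) (auto simp: mfps_order_ge_def)
qed

lemma const_term_subst:
  assumes "\<And>i. mfps_const_term (F i) = 0" and "mfps_const_term f = 0"
  shows "mfps_const_term (mfps_subst F f) = 0"
  using assms order_ge_subst[of F 1 f] by (simp add: const_term_eq_0_iff)

text \<open>
  Expanding the outer and the inner substitution and exchanging the two finite sums leaves
  \<open>\<Sum>\<^sub>t f\<^sub>t \<cdot> (H\<^sup>t)(F)\<close>; the homomorphism property turns \<open>(H\<^sup>t)(F)\<close> into the monomial in the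
  series \<open>H i (F)\<close>.
\<close>

lemma subst_subst:
  fixes F :: "'v::finite \<Rightarrow> ('w::finite, 'a::comm_ring_1) mfps"
    and H :: "'u::finite \<Rightarrow> ('v, 'a) mfps"
  assumes F: "\<And>i. mfps_const_term (F i) = 0" and H: "\<And>i. mfps_const_term (H i) = 0"
  shows "mfps_subst F (mfps_subst H f) = mfps_subst (\<lambda>i. mfps_subst F (H i)) f"
  unfolding mfps_eq_iff
proof
  fix m :: "'w \<Rightarrow> nat"
  define M where "M = (\<lambda>s. \<Prod>i\<in>UNIV. F i ^ s i)"
  define M' where "M' = (\<lambda>t. \<Prod>i\<in>UNIV. H i ^ t i)"
  let ?le = "\<lambda>s. mdegree s \<le> mdegree m"
  have "mfps_coeff (mfps_subst F (mfps_subst H f)) m =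
      (\<Sum>s | ?le s. \<Sum>t | ?le t. mfps_coeff f t * mfps_coeff (M' t) s * mfps_coeff (M s) m)"
    unfolding coeff_subst[OF F order_refl]
    by (intro sum.cong refl)
      (simp add: coeff_subst[OF H, where N = "mdegree m"] sum_distrib_right M_def M'_def)
  also have "\<dots> = (\<Sum>t | ?le t. \<Sum>s | ?le s. mfps_coeff f t * mfps_coeff (M' t) s * mfps_coeff (M s) m)"
    by (rule sum.swap)
  also have "\<dots> = (\<Sum>t | ?le t. mfps_coeff f t * mfps_coeff (mfps_subst F (M' t)) m)"
    by (simp add: coeff_subst[OF F order_refl] sum_distrib_left M_def mult.assoc)
  also have "\<dots> = mfps_coeff (mfps_subst (\<lambda>i. mfps_subst F (H i)) f) m"
    by (simp add: coeff_subst[OF const_term_subst[OF F H] order_refl] M'_def subst_monomial[OF F])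
  finally show "mfps_coeff (mfps_subst F (mfps_subst H f)) m =
    mfps_coeff (mfps_subst (\<lambda>i. mfps_subst F (H i)) f) m" .
qed

section \<open>Variables as units of substitution\<close>

lemma mdegree_unit [simp]: "mdegree (\<lambda>j. if j = i then 1 else 0) = 1"
  by (simp add: mdegree_def)

lemma const_term_var [simp]: "mfps_const_term (mfps_var i) = 0"
  by (auto simp: mfps_const_term_def mfps_var.rep_eq fun_eq_iff)

lemma subst_var [simp]:
  assumes "\<And>i. mfps_const_term (F i) = 0"
  shows "mfps_subst F (mfps_var i) = F i"
  unfolding mfps_eq_iff
proof
  fix m
  let ?e = "\<lambda>j. if j = i then 1 else (0::nat)"
  have prod: "(\<Prod>j\<in>UNIV. F j ^ ?e j) = F i"
    by (simp add: if_distrib[of "(^) _"] prod.delta cong: if_cong)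
  have "mfps_coeff (mfps_subst F (mfps_var i)) m =
      (\<Sum>s\<in>{?e}. mfps_coeff (\<Prod>j\<in>UNIV. F j ^ s j) m)"
    \<comment> \<open>The degree bound is raised by one so that the index set contains the exponent of
      \<open>mfps_var i\<close> even when \<open>m\<close> is the zero exponent.\<close>
    unfolding coeff_subst[OF assms le_SucI[OF order_refl]]
    by (intro sum.mono_neutral_cong_right finite_mdegree_le) (auto simp: mfps_var.rep_eq)
  then show "mfps_coeff (mfps_subst F (mfps_var i)) m = mfps_coeff (F i) m"
    by (simp add: prod)
qed

lemma coeff_var_mult:
  "mfps_coeff (mfps_var i * f) m = (if m i = 0 then 0 else mfps_coeff f (m(i := m i - 1)))"
proof -
  let ?e = "\<lambda>j. if j = i then 1 else (0::nat)"
  have e: "?e \<le> m \<longleftrightarrow> m i \<noteq> 0" 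
    by (auto simp: le_fun_def)
  have diff: "(\<lambda>j. m j - ?e j) = m(i := m i - 1)"
    by auto
  have "mfps_coeff (mfps_var i * f) m =
      (\<Sum>k | k \<le> m. if k = ?e then mfps_coeff f (\<lambda>j. m j - k j) else 0)"
    unfolding times_mfps.rep_eq by (intro sum.cong) (auto simp: mfps_var.rep_eq)
  also have "\<dots> = (if m i = 0 then 0 else mfps_coeff f (\<lambda>j. m j - ?e j))"
    using e by (simp add: sum.delta[OF finite_exponents_le])
  finally show ?thesis
    unfolding diff .
qed

lemma coeff_var_monomial:
  fixes s m :: "'v::finite \<Rightarrow> nat"
  shows "mfps_coeff (\<Prod>i\<in>UNIV. mfps_var i ^ s i) m = (if m = s then 1 else (0 :: 'a::comm_ring_1))"
proof -
  have power: "mfps_coeff (mfps_var i ^ n * f) m =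
      (if m i < n then 0 else mfps_coeff f (m(i := m i - n)))" for i n and f :: "('v, 'a) mfps" and m :: "'v \<Rightarrow> nat"
    by (induction n arbitrary: m) (auto simp: coeff_var_mult mult.assoc)
  have "mfps_coeff (\<Prod>i\<in>A. mfps_var i ^ s i) m = (if m = (\<lambda>i. if i \<in> A then s i else 0) then 1 else (0 :: 'a))"
    if "finite A" for A :: "'v set" and m
    using that
  proof (induction arbitrary: m)
    case (insert i A)
    then show ?case
      by (auto simp: power fun_eq_iff)
  qed (simp add: one_mfps.rep_eq)
  then show ?thesis
    by simp
qed

section \<open>The compositional inverse\<close>

text \<open>
  The equation \<open>f(G) = t\<close> will be solved by recursion on the degree of the exponent: with \<open>c s m\<close> the
  coefficient of \<open>m\<close> in the \<open>s\<close>-th monomial in \<open>G\<close>, the matrix \<open>c\<close> is unitriangular with respect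
  to the degree.
\<close>

function triangular_solution ::
  "(('v::finite \<Rightarrow> nat) \<Rightarrow> ('v \<Rightarrow> nat) \<Rightarrow> 'a::comm_ring_1) \<Rightarrow> (('v \<Rightarrow> nat) \<Rightarrow> 'a) \<Rightarrow> ('v \<Rightarrow> nat) \<Rightarrow> 'a" where
  "triangular_solution c t m = t m - (\<Sum>s | mdegree s < mdegree m. triangular_solution c t s * c s m)"
  by auto
termination
  by (relation "measure (\<lambda>(c, t, m). mdegree m)") auto

declare triangular_solution.simps [simp del]

lemma same_leading_var:
  fixes g :: "('v::finite, 'a::comm_ring_1) mfps"
  assumes "mfps_cong_deg2 g (mfps_var i)"
  shows "mfps_same_leading 1 g (mfps_var i)"
proof -
  have "mfps_order_ge 2 (g - mfps_var i)" and "mfps_order_ge 1 (mfps_var i :: ('v, 'a) mfps)"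
    using assms by (simp_all add: cong_deg2_iff flip: const_term_eq_0_iff del: One_nat_def)
  then show ?thesis
    using order_ge_add[of 1 "g - mfps_var i" "mfps_var i"]
    by (auto simp: mfps_same_leading_def numeral_2_eq_2 intro: order_ge_mono)
qed

lemma const_term_cong_var:
  assumes "mfps_cong_deg2 g (mfps_var i)"
  shows "mfps_const_term g = 0"
  using same_leading_var[OF assms] by (simp add: mfps_same_leading_def const_term_eq_0_iff)

lemma coeff_subst_triangular:
  fixes G :: "'v::finite \<Rightarrow> ('v, 'a::comm_ring_1) mfps"
  assumes G: "\<And>i. mfps_cong_deg2 (G i) (mfps_var i)"
  shows "mfps_coeff (mfps_subst G f) m = mfps_coeff f m +
    (\<Sum>s | mdegree s < mdegree m. mfps_coeff f s * mfps_coeff (\<Prod>i\<in>UNIV. G i ^ s i) m)"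
proof -
  let ?c = "\<lambda>s. mfps_coeff (\<Prod>i\<in>UNIV. G i ^ s i) m"
  have c: "?c s = (if s = m then 1 else 0)" if "mdegree s = mdegree m" for s
  proof -
    have "mfps_coeff ((\<Prod>i\<in>UNIV. G i ^ s i) - (\<Prod>i\<in>UNIV. mfps_var i ^ s i)) m = 0"
      using same_leading_monomial[OF same_leading_var[OF G], of s] that
      by (simp add: mfps_same_leading_def mfps_order_ge_def)
    then show ?thesis
      by (auto simp: minus_mfps.rep_eq coeff_var_monomial)
  qed
  have "{s. mdegree s \<le> mdegree m} = {s. mdegree s = mdegree m} \<union> {s. mdegree s < mdegree m}"
    by auto
  moreover have "finite {s :: 'v \<Rightarrow> nat. mdegree s = mdegree m}" "finite {s :: 'v \<Rightarrow> nat. mdegree s < mdegree m}"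
    by (rule finite_subset[OF _ finite_mdegree_le[of "mdegree m"]]; auto)+
  ultimately have "mfps_coeff (mfps_subst G f) m =
      (\<Sum>s | mdegree s = mdegree m. mfps_coeff f s * ?c s) +
      (\<Sum>s | mdegree s < mdegree m. mfps_coeff f s * ?c s)"
    unfolding coeff_subst[OF const_term_cong_var[OF G] order_refl]
    by (subst sum.union_disjoint[symmetric]) (auto intro: sum.cong)
  also have "(\<Sum>s | mdegree s = mdegree m. mfps_coeff f s * ?c s) =
      (\<Sum>s | mdegree s = mdegree m. if s = m then mfps_coeff f s else 0)"
    by (intro sum.cong) (auto simp: c)
  also have "\<dots> = mfps_coeff f m"
    using \<open>finite {s :: 'v \<Rightarrow> nat. mdegree s = mdegree m}\<close> by (simp add: sum.delta)
  finally show ?thesis .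
qed

text \<open>A unitriangular system is solvable over any ring, without division.\<close>

lemma subst_surj:
  assumes "\<And>i. mfps_cong_deg2 (G i) (mfps_var i)"
  obtains f where "mfps_subst G f = t"
proof
  let ?c = "\<lambda>s. mfps_coeff (\<Prod>i\<in>UNIV. G i ^ s i)"
  show "mfps_subst G (Abs_mfps (triangular_solution ?c (mfps_coeff t))) = t"
    unfolding mfps_eq_iff
  proof
    fix m
    show "mfps_coeff (mfps_subst G (Abs_mfps (triangular_solution ?c (mfps_coeff t)))) m = mfps_coeff t m"
      unfolding coeff_subst_triangular[OF assms]
      by (simp add: Abs_mfps_inverse triangular_solution.simps[of _ _ m])
  qed
qed

text \<open>
  If \<open>mdegree m < 2\<close>, the only exponent of degree less than \<open>mdegree m\<close> can be the zero exponent;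
  its monomial is the series 1, which has no coefficient at \<open>m\<close>. So the triangular system is
  diagonal there.
\<close>

lemma cong_deg2_subst_arg:
  fixes G :: "'v::finite \<Rightarrow> ('v, 'a::comm_ring_1) mfps"
  assumes G: "\<And>i. mfps_cong_deg2 (G i) (mfps_var i)"
  shows "mfps_cong_deg2 (mfps_subst G f) f"
  unfolding mfps_cong_deg2_def
proof (intro allI impI)
  fix m :: "'v \<Rightarrow> nat"
  assume "mdegree m < 2"
  have "mfps_coeff f s * mfps_coeff (\<Prod>i\<in>UNIV. G i ^ s i) m = 0" if "mdegree s < mdegree m" for s
  proof -
    have "s = (\<lambda>_. 0)" "m \<noteq> (\<lambda>_. 0)"
      using that \<open>mdegree m < 2\<close> by (auto simp flip: mdegree_eq_0_iff)
    then show ?thesis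
      by (simp add: one_mfps.rep_eq)
  qed
  then show "mfps_coeff (mfps_subst G f) m = mfps_coeff f m"
    by (simp add: coeff_subst_triangular[OF G])
qed

lemma left_inverse_exists:
  assumes "\<And>i. mfps_cong_deg2 (G i) (mfps_var i)"
  obtains H where "\<And>i. mfps_cong_deg2 (H i) (mfps_var i)" and "mfps_compose H G = mfps_var"
proof -
  have "\<forall>i. \<exists>h. mfps_subst G h = mfps_var i"
    using subst_surj[OF assms] by metis
  then obtain H where H: "\<And>i. mfps_subst G (H i) = mfps_var i"
    by metis
  have "mfps_cong_deg2 (H i) (mfps_var i)" for i
    using cong_deg2_subst_arg[OF assms, of "H i"] by (simp add: H mfps_cong_deg2_def)
  moreover have "mfps_compose H G = mfps_var"
    by (simp add: mfps_compose_def H fun_eq_iff)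
  ultimately show ?thesis
    by (rule that)
qed

lemma subst_vars: "mfps_subst mfps_var f = f"
  by (auto simp: mfps_eq_iff coeff_subst_triangular mfps_cong_deg2_def coeff_var_monomial
      intro: sum.neutral)

lemma compose_var_right [simp]: "mfps_compose P mfps_var = P"
  by (simp add: mfps_compose_def subst_vars)

lemma compose_var_left:
  assumes "\<And>i. mfps_const_term (F i) = 0"
  shows "mfps_compose mfps_var F = F"
  by (simp add: mfps_compose_def assms)

lemma compose_assoc:
  assumes "\<And>i. mfps_const_term (H i) = 0" and "\<And>i. mfps_const_term (F i) = 0"
  shows "mfps_compose (mfps_compose P H) F = mfps_compose P (mfps_compose H F)"
  by (simp add: mfps_compose_def subst_subst assms)

lemma const_term_compose:
  assumes "\<And>i. mfps_const_term (F i) = 0" and "\<And>i. mfps_const_term (P i) = 0"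
  shows "mfps_const_term (mfps_compose P F i) = 0"
  by (simp add: mfps_compose_def const_term_subst assms)

lemma cong_deg2_compose:
  assumes "\<And>i. mfps_cong_deg2 (P i) (mfps_var i)" and F: "\<And>i. mfps_const_term (F i) = 0"
  shows "mfps_cong_deg2 (mfps_compose P F i) (F i)"
proof -
  have "mfps_compose P F i = mfps_subst F ((P i - mfps_var i) + mfps_var i)"
    by (simp add: mfps_compose_def)
  also have "\<dots> = mfps_subst F (P i - mfps_var i) + F i"
    using F by (subst subst_add) simp_all
  finally have "mfps_compose P F i - F i = mfps_subst F (P i - mfps_var i)"
    by simp
  then show ?thesis
    using order_ge_subst[of F 2 "P i - mfps_var i"] F assms(1) by (simp add: cong_deg2_iff)
qed

text \<open>
  Left inverses suffice: the left inverse \<open>H\<close> of \<open>G\<close> satisfies the same hypothesis as \<open>G\<close>, so it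
  has a left inverse \<open>K\<close> in turn, and \<open>K = K \<circ> (H \<circ> G) = (K \<circ> H) \<circ> G = G\<close>.
\<close>

lemma comp_inverse:
  fixes G :: "'n::finite \<Rightarrow> ('n, 'a::comm_ring_1) mfps"
  assumes G: "\<And>i. mfps_cong_deg2 (G i) (mfps_var i)"
  shows cong_deg2_comp_inverse: "mfps_cong_deg2 (mfps_comp_inverse G i) (mfps_var i)"
    and compose_comp_inverse_right: "mfps_compose G (mfps_comp_inverse G) = mfps_var"
    and compose_comp_inverse_left: "mfps_compose (mfps_comp_inverse G) G = mfps_var"
proof -
  have G0: "mfps_const_term (G i) = 0" for i
    by (rule const_term_cong_var[OF G])
  obtain H where H: "\<And>i. mfps_cong_deg2 (H i) (mfps_var i)" and HG: "mfps_compose H G = mfps_var"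
    using left_inverse_exists[OF G] by blast
  obtain K where K: "\<And>i. mfps_cong_deg2 (K i) (mfps_var i)" and KH: "mfps_compose K H = mfps_var"
    using left_inverse_exists[OF H] by blast
  have H0: "mfps_const_term (H i) = 0" for i
    by (rule const_term_cong_var[OF H])
  have "K = mfps_compose K (mfps_compose H G)"
    by (simp add: HG)
  also have "\<dots> = G"
    by (simp add: compose_assoc[symmetric] compose_var_left H0 G0 KH)
  finally have GH: "mfps_compose G H = mfps_var"
    using KH by simp
  have unique: "H' = H" if "\<And>i. mfps_const_term (H' i) = 0" "mfps_compose H' G = mfps_var" for H'
  proof -
    have "H' = mfps_compose H' (mfps_compose G H)"
      by (simp add: GH)
    also have "\<dots> = H"
      by (simp add: compose_assoc[symmetric] compose_var_left H0 G0 that)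
    finally show ?thesis .
  qed
  have "mfps_comp_inverse G = H"
    unfolding mfps_comp_inverse_def by (rule the_equality) (use H0 GH HG unique in auto)
  then show "mfps_cong_deg2 (mfps_comp_inverse G i) (mfps_var i)"
    "mfps_compose G (mfps_comp_inverse G) = mfps_var"
    "mfps_compose (mfps_comp_inverse G) G = mfps_var"
    by (simp_all add: H GH HG)
qed

section \<open>Transport of structure\<close>

lemma const_term_x2_y2 [simp]: "mfps_const_term (x2 i) = 0" "mfps_const_term (y2 i) = 0"
  by (simp_all add: x2_def y2_def)

lemma const_term_x3_y3_z3 [simp]:
  "mfps_const_term (x3 i) = 0" "mfps_const_term (y3 i) = 0" "mfps_const_term (z3 i) = 0"
  by (simp_all add: x3_def y3_def z3_def)

lemma const_term_add_mult:
  assumes "mfps_const_term f = 0" and "mfps_const_term g = 0"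
  shows "mfps_const_term (f + g) = 0" and "mfps_const_term (f * g) = 0"
  using assms order_ge_mult[of 1 f 1 g] order_ge_mono[of 2 "f * g" 1]
  by (auto simp: const_term_eq_0_iff numeral_2_eq_2 intro: order_ge_add)

lemma apply2_x2_y2:
  assumes a: "\<And>i. mfps_const_term (a i) = 0" and b: "\<And>i. mfps_const_term (b i) = 0"
  shows "mfps_apply2 (mfps_compose G x2) a b = mfps_compose G a"
    and "mfps_apply2 (mfps_compose G y2) a b = mfps_compose G b"
proof -
  have ab: "mfps_const_term (case_sum a b j) = 0" for j
    by (cases j) (simp_all add: a b)
  have "mfps_compose x2 (case_sum a b) = a" "mfps_compose y2 (case_sum a b) = b"
    by (simp_all add: mfps_compose_def x2_def y2_def ab)
  then show "mfps_apply2 (mfps_compose G x2) a b = mfps_compose G a"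
    "mfps_apply2 (mfps_compose G y2) a b = mfps_compose G b"
    by (simp_all add: mfps_apply2_def compose_assoc ab)
qed

locale coordinate_change =
  fixes G :: "'n::finite \<Rightarrow> ('n, 'a::comm_ring_1) mfps"
  assumes cong_var: "\<And>i. mfps_cong_deg2 (G i) (mfps_var i)"
begin

lemma const_term_G [simp]: "mfps_const_term (G i) = 0"
  by (rule const_term_cong_var[OF cong_var])

abbreviation H :: "'n \<Rightarrow> ('n, 'a) mfps" where "H \<equiv> mfps_comp_inverse G"

lemma const_term_H [simp]: "mfps_const_term (H i) = 0"
  by (rule const_term_cong_var[OF cong_deg2_comp_inverse[OF cong_var]])

text \<open>The cancellation that collapses nested applications of the transported operations.\<close>

lemma compose_G_H:
  assumes "\<And>i. mfps_const_term (u i) = 0"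
  shows "mfps_compose G (mfps_compose H u) = u"
  by (simp add: compose_assoc[symmetric] assms compose_comp_inverse_right[OF cong_var]
      compose_var_left)

definition transported_sum where
  "transported_sum = mfps_compose H (\<lambda>j. mfps_compose G x2 j + mfps_compose G y2 j)"

definition transported_product where
  "transported_product = mfps_compose H (\<lambda>j. mfps_compose G x2 j * mfps_compose G y2 j)"

lemma apply2_compose_H:
  assumes a: "\<And>i. mfps_const_term (a i) = 0" and b: "\<And>i. mfps_const_term (b i) = 0"
    and w: "\<And>j. mfps_const_term (w j) = 0"
  shows "mfps_apply2 (mfps_compose H w) a b = mfps_compose H (mfps_apply2 w a b)"
proof -
  have "mfps_const_term (case_sum a b j) = 0" for j
    by (cases j) (simp_all add: a b)
  then show ?thesis
    by (simp add: mfps_apply2_def compose_assoc w)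
qed

lemma apply2_transported:
  assumes a: "\<And>i. mfps_const_term (a i) = 0" and b: "\<And>i. mfps_const_term (b i) = 0"
  shows apply2_transported_sum: "mfps_apply2 transported_sum a b =
      mfps_compose H (\<lambda>j. mfps_compose G a j + mfps_compose G b j)"
    and apply2_transported_product: "mfps_apply2 transported_product a b =
      mfps_compose H (\<lambda>j. mfps_compose G a j * mfps_compose G b j)"
proof -
  have ab: "mfps_const_term (case_sum a b j) = 0" for j
    by (cases j) (simp_all add: a b)
  have G_ab: "mfps_subst (case_sum a b) (mfps_compose G x2 j) = mfps_compose G a j"
    "mfps_subst (case_sum a b) (mfps_compose G y2 j) = mfps_compose G b j" for j
    using apply2_x2_y2[of a b G] a b by (simp_all add: mfps_apply2_def mfps_compose_def fun_eq_iff)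
  show "mfps_apply2 transported_sum a b =
      mfps_compose H (\<lambda>j. mfps_compose G a j + mfps_compose G b j)"
    unfolding transported_sum_def
    by (subst apply2_compose_H)
      (simp_all add: a b const_term_add_mult const_term_compose mfps_apply2_def
        mfps_compose_def[of "\<lambda>j. _ j + _ j"] subst_add ab G_ab)
  show "mfps_apply2 transported_product a b =
      mfps_compose H (\<lambda>j. mfps_compose G a j * mfps_compose G b j)"
    unfolding transported_product_def
    by (subst apply2_compose_H)
      (simp_all add: a b const_term_add_mult const_term_compose mfps_apply2_def
        mfps_compose_def[of "\<lambda>j. _ j * _ j"] subst_mult ab G_ab)
qed

text \<open>Both \<open>G\<close> and \<open>H\<close> act as the identity modulo degree 2, so the linear part is that of addition.\<close>

lemma cong_deg2_transported_sum: "mfps_cong_deg2 (transported_sum i) (x2 i + y2 i)"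
proof -
  have "mfps_cong_deg2 (transported_sum i) (mfps_compose G x2 i + mfps_compose G y2 i)"
    unfolding transported_sum_def
    by (rule cong_deg2_compose[OF cong_deg2_comp_inverse[OF cong_var]])
      (simp add: const_term_add_mult const_term_compose)
  moreover have "mfps_cong_deg2 (mfps_compose G x2 i) (x2 i)" "mfps_cong_deg2 (mfps_compose G y2 i) (y2 i)"
    by (simp_all add: cong_deg2_compose[OF cong_var])
  ultimately show ?thesis
    by (simp add: mfps_cong_deg2_def plus_mfps.rep_eq)
qed

text \<open>
  After cancelling every \<open>G \<circ> H\<close>, each axiom is the corresponding identity of the commutative ring
  of power series, coordinate by coordinate.
\<close>

lemma commutative_formal_ring_transported:
  "commutative_formal_ring transported_sum transported_product"
proof -
  note simps = apply2_transported const_term_compose const_term_add_mult compose_G_H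
  have "mfps_const_term (transported_product i) = 0" for i
    by (simp add: transported_product_def simps)
  then show ?thesis
    unfolding commutative_formal_ring_def formal_ring_def formal_group_law_def mfps_symmetric_def
    using cong_deg2_transported_sum by (simp add: simps algebra_simps)
qed

end

theorem theorem2:
  fixes G :: "'n::finite \<Rightarrow> ('n, 'a::{comm_ring_1, ring_char_0}) mfps"
    and \<Phi> \<Psi> :: "'n \<Rightarrow> ('n + 'n, 'a) mfps"
  assumes "\<And>i. mfps_cong_deg2 (G i) (mfps_var i)"
    and "\<Phi> = mfps_compose (mfps_comp_inverse G)
          (\<lambda>j. mfps_compose G x2 j + mfps_compose G y2 j)"
    and "\<Psi> = mfps_compose (mfps_comp_inverse G)
          (\<lambda>j. mfps_compose G x2 j * mfps_compose G y2 j)"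
  shows "commutative_formal_ring \<Phi> \<Psi>"
proof -
  interpret coordinate_change G
    by unfold_locales (rule assms(1))
  show ?thesis
    using commutative_formal_ring_transported
    by (simp add: assms(2,3) transported_sum_def transported_product_def)
qed

end
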